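(* Let $K$ be an algebraically closed field, let $N\geq 1$, let $M\subset K[\mathbf{P}^N]$ be the ideal generated by the variables, and let $(0)\neq I\subsetneq K[\mathbf{P}^N]$ be a homogeneous ideal such that $I^{(r)}=I^r$ for all $r\geq 1$. Then for all integers $r,m,t\geq 1$: (i) $I^{(rN)}\subseteq M^{r(N-1)}I^r$; (ii) $I^{(rN-(N-1))}\subseteq I^r$; (iii) if $N=2$ and $m/r\geq 2\alpha(I)/(\alpha(I)+1)$, then $I^{(m)}\subseteq I^r$; (iv) $I^{(rN-(N-1))}\subseteq M^{(r-1)(N-1)}I^r$; (v) $\alpha(I^{(rN-(N-1))})\geq r\alpha(I)+(r-1)(N-1)$; (vi) $\dfrac{\alpha(I^{(m)})+N-1}{m+N-1}\leq\dfrac{\alpha(I^{(r)})}{r}$; (vii) if $N\geq 2$, then $I^{(t(m+N-1))}\subseteq M^t(I^{(m)})^t$; (viii) $I^{(t(m+N-1))}\subseteq M^{t(N-1)}(I^{(m)})^t$; (ix) $I^{(t(m+N-1)-N+1)}\subseteq (I^{(m)})^t$ and $I^{(t(m+N-1)-N+1)}\subseteq M^{(t-1)(N-1)}(I^{(m)})^t$.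
   Context: For a nonzero homogeneous ideal $J\subseteq K[\mathbf{P}^N]=K[x_0,\ldots,x_N]$, $\alpha(J)$ is the least degree of a nonzero form in $J$. Symbolic powers: let $P_i$ be the associated primes of $I$ and let $I^m=\bigcap_j Q'_j$ be a homogeneous primary decomposition with $Q'_j$ being $P'_j$-primary, $P'_j$ the associated primes of $I^m$; then $I^{(m)}=\bigcap_{j:\,P'_j\subseteq P_i\text{ for some }i}Q'_j$. For any ideal $J$, $J^0$ is the whole ring. *)

theory Defs
  imports
    "HOL-Library.Cardinality"
    "HOL-Library.Poly_Mapping"
    "HOL-Algebra.Ideal_Product"
    "HOL-Algebra.Algebraic_Closure_Type"
begin

(* K[x_i | i :: 'n]: a monomial is its exponent vector, a polynomial its finitely
   supported coefficient function.  K[P^N] is the case CARD('n) = N + 1. *)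
type_synonym ('n, 'k) mpoly = "('n \<Rightarrow>\<^sub>0 nat) \<Rightarrow>\<^sub>0 'k"

abbreviation mpoly_ring :: "('n::finite, 'k::field) mpoly ring" where
  "mpoly_ring \<equiv> ring_of_type_algebra"

definition mpoly_var :: "'n::finite \<Rightarrow> ('n, 'k::field) mpoly" where
  "mpoly_var i = Poly_Mapping.single (Poly_Mapping.single i 1) 1"

(* The zero polynomial is a form of every degree. *)
definition is_form :: "nat \<Rightarrow> ('n::finite, 'k::field) mpoly \<Rightarrow> bool" where
  "is_form d f \<longleftrightarrow> (\<forall>e \<in> Poly_Mapping.keys f. (\<Sum>i\<in>UNIV. Poly_Mapping.lookup e i) = d)"

definition homogeneous_ideal :: "('n::finite, 'k::field) mpoly set \<Rightarrow> bool" where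
  "homogeneous_ideal I \<longleftrightarrow>
     ideal I mpoly_ring \<and> (\<exists>S. (\<forall>f\<in>S. \<exists>d. is_form d f) \<and> I = genideal mpoly_ring S)"

definition irrelevant_ideal :: "('n::finite, 'k::field) mpoly set" where
  "irrelevant_ideal = genideal mpoly_ring (range mpoly_var)"

definition alpha :: "('n::finite, 'k::field) mpoly set \<Rightarrow> nat" where
  "alpha J = (LEAST d. \<exists>f\<in>J. f \<noteq> 0 \<and> is_form d f)"

(* Power in the multiplicative monoid of ideals, whose unit is the whole ring;
   so the 0th power of any ideal is the whole ring. *)
definition ideal_power :: "('n::finite, 'k::field) mpoly set \<Rightarrow> nat \<Rightarrow> ('n, 'k) mpoly set" where
  "ideal_power I m = I [^]\<^bsub>ideals_set mpoly_ring\<^esub> m"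

definition ideal_radical :: "('a, 'b) ring_scheme \<Rightarrow> 'a set \<Rightarrow> 'a set" where
  "ideal_radical R Q = {x \<in> carrier R. \<exists>n::nat. x [^]\<^bsub>R\<^esub> n \<in> Q}"

definition primary_to :: "('a, 'b) ring_scheme \<Rightarrow> 'a set \<Rightarrow> 'a set \<Rightarrow> bool" where
  "primary_to R P Q \<longleftrightarrow>
     ideal Q R \<and> Q \<noteq> carrier R \<and>
     (\<forall>x\<in>carrier R. \<forall>y\<in>carrier R.
        x \<otimes>\<^bsub>R\<^esub> y \<in> Q \<longrightarrow> x \<in> Q \<or> y \<in> ideal_radical R Q) \<and>
     ideal_radical R Q = P"

(* The associated primes of the R-module R/I: prime ideals of the form (I : f). *)
definition associated_primes :: "('a, 'b) ring_scheme \<Rightarrow> 'a set \<Rightarrow> 'a set set" where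
  "associated_primes R I =
     {P. primeideal P R \<and> (\<exists>f\<in>carrier R. P = {g \<in> carrier R. g \<otimes>\<^bsub>R\<^esub> f \<in> I})}"

(* The components are indexed by the associated primes: Q P is the P-primary one. *)
definition homogeneous_primary_decomposition ::
  "('n::finite, 'k::field) mpoly set \<Rightarrow>
   (('n, 'k) mpoly set \<Rightarrow> ('n, 'k) mpoly set) \<Rightarrow> bool" where
  "homogeneous_primary_decomposition J Q \<longleftrightarrow>
     (\<forall>P \<in> associated_primes mpoly_ring J.
        homogeneous_ideal (Q P) \<and> primary_to mpoly_ring P (Q P)) \<and>
     J = (\<Inter>P \<in> associated_primes mpoly_ring J. Q P)"

(* For homogeneous I a decomposition of I^m exists (Lasker-Noether), and the
   intersection does not depend on which one is chosen: the primes it runs over form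
   a downward closed set of associated primes of I^m. *)
definition symbolic_power :: "('n::finite, 'k::field) mpoly set \<Rightarrow> nat \<Rightarrow> ('n, 'k) mpoly set" where
  "symbolic_power I m =
     (let Q = (SOME Q. homogeneous_primary_decomposition (ideal_power I m) Q)
      in \<Inter>P \<in> {P' \<in> associated_primes mpoly_ring (ideal_power I m).
                \<exists>P\<^sub>0 \<in> associated_primes mpoly_ring I. P' \<subseteq> P\<^sub>0}. Q P)"

end

theory Submission
  imports Defs
begin

text \<open>
  Since the symbolic powers of \<open>I\<close> agree with its ordinary powers, every claim is about
  ordinary powers. A proper homogeneous ideal lies in \<open>M\<close>, so surplus factors of \<open>I\<close> in
  \<open>I\<^sup>n\<close> may be traded for factors of \<open>M\<close>; this gives the containments. The numerical claims
  follow from \<open>\<alpha>(I\<^sup>s) = s \<alpha>(I)\<close>, which holds as a polynomial ring is a domain, and from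
  \<open>\<alpha>(I) \<ge> 1\<close>.
\<close>

section \<open>Ideals of a type-class ring in terms of its own operations\<close>

lemma ring_of_type_algebra_simps [simp]:
  "carrier ring_of_type_algebra = UNIV"
  "x \<otimes>\<^bsub>ring_of_type_algebra\<^esub> y = x * y"
  "x \<oplus>\<^bsub>ring_of_type_algebra\<^esub> y = x + y"
  "\<one>\<^bsub>ring_of_type_algebra\<^esub> = 1"
  "\<zero>\<^bsub>ring_of_type_algebra\<^esub> = 0"
  by (simp_all add: ring_of_type_algebra_def)

text \<open>Additive inverses come from multiplication by \<open>-1\<close>, and absorption on the
  other side from commutativity.\<close>

lemma ideal_ring_of_type_algebraI:
  fixes J :: "'a::comm_ring_1 set"
  assumes "0 \<in> J" and "\<And>x y. x \<in> J \<Longrightarrow> y \<in> J \<Longrightarrow> x + y \<in> J"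
    and "\<And>c x. x \<in> J \<Longrightarrow> c * x \<in> J"
  shows "ideal J ring_of_type_algebra"
proof (rule idealI)
  interpret cring "ring_of_type_algebra :: 'a ring" by (rule cring_from_type_algebra)
  show "ring (ring_of_type_algebra :: 'a ring)" by (rule ring_from_type_algebra)
  have minus: "\<ominus>\<^bsub>ring_of_type_algebra\<^esub> x = - x" for x :: 'a
    by (rule minus_equality) auto
  show "subgroup J (add_monoid (ring_of_type_algebra :: 'a ring))"
  proof (rule add.subgroupI)
    show "J \<noteq> {}" using assms(1) by blast
    show "\<ominus>\<^bsub>ring_of_type_algebra\<^esub> x \<in> J" if "x \<in> J" for x
      using assms(3)[OF that, of "-1"] by (simp add: minus)
  qed (use assms(2) in auto)
qed (use assms(3) in \<open>auto simp: mult.commute\<close>)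

lemma ideal_ring_of_type_algebraD:
  fixes J :: "'a::comm_ring_1 set"
  assumes "ideal J ring_of_type_algebra"
  shows "0 \<in> J" and "x \<in> J \<Longrightarrow> y \<in> J \<Longrightarrow> x + y \<in> J" and "x \<in> J \<Longrightarrow> c * x \<in> J"
proof -
  interpret ideal J "ring_of_type_algebra :: 'a ring" by fact
  show "0 \<in> J" using additive_subgroup.zero_closed[OF is_additive_subgroup] by simp
  show "x + y \<in> J" if "x \<in> J" "y \<in> J" using additive_subgroup.a_closed[OF is_additive_subgroup that] by simp
  show "c * x \<in> J" if "x \<in> J" using I_l_closed[OF that, of c] by simp
qed

lemma ideal_prod_mono:
  assumes "I \<subseteq> I'" and "J \<subseteq> J'"
  shows "ideal_prod R I J \<subseteq> ideal_prod R I' J'"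
proof
  fix x assume "x \<in> ideal_prod R I J"
  then show "x \<in> ideal_prod R I' J'"
    by induction (use assms in \<open>auto intro: ideal_prod.intros\<close>)
qed

subsection \<open>Powers of ideals\<close>

interpretation mpoly: cring "mpoly_ring :: ('n::finite, 'k::field) mpoly ring"
  by (rule cring_from_type_algebra)

text \<open>Ideals form a commutative monoid under the product, so the exponent laws for
  \<open>ideal_power\<close> become instances of those for monoid powers.\<close>

interpretation mpoly_ideals:
  comm_monoid "ideals_set (mpoly_ring :: ('n::finite, 'k::field) mpoly ring)"
  rewrites "carrier (ideals_set mpoly_ring) = {I. ideal I mpoly_ring}"
    and "monoid.mult (ideals_set mpoly_ring) = ideal_prod mpoly_ring"
    and "monoid.one (ideals_set mpoly_ring) = UNIV"
  by (rule mpoly.ideals_set_is_comm_monoid) (simp_all add: ideals_set_def)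

lemma ideal_power_0 [simp]: "ideal_power I 0 = UNIV"
  unfolding ideal_power_def by (rule mpoly_ideals.nat_pow_0)

lemma ideal_power_Suc: "ideal_power I (Suc n) = ideal_prod mpoly_ring (ideal_power I n) I"
  unfolding ideal_power_def by (rule mpoly_ideals.nat_pow_Suc)

lemma ideal_ideal_power:
  "ideal I mpoly_ring \<Longrightarrow> ideal (ideal_power I n) mpoly_ring"
  using mpoly_ideals.nat_pow_closed[of I n] by (simp add: ideal_power_def)

lemma ideal_power_add:
  "ideal I mpoly_ring \<Longrightarrow>
    ideal_power I (m + n) = ideal_prod mpoly_ring (ideal_power I m) (ideal_power I n)"
  using mpoly_ideals.nat_pow_mult[of I m n] by (simp add: ideal_power_def)

lemma ideal_power_power:
  "ideal I mpoly_ring \<Longrightarrow> ideal_power (ideal_power I m) n = ideal_power I (m * n)"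
  using mpoly_ideals.nat_pow_pow[of I m n] by (simp add: ideal_power_def)

lemma ideal_power_mono: "I \<subseteq> J \<Longrightarrow> ideal_power I n \<subseteq> ideal_power J n"
  by (induction n) (simp_all add: ideal_power_Suc ideal_prod_mono)

lemma ideal_power_antimono:
  assumes I: "ideal I mpoly_ring" and "m \<le> n"
  shows "ideal_power I n \<subseteq> ideal_power I m"
proof -
  have "ideal_power I n = ideal_prod mpoly_ring (ideal_power I m) (ideal_power I (n - m))"
    using ideal_power_add[OF I, of m "n - m"] \<open>m \<le> n\<close> by simp
  also have "\<dots> \<subseteq> ideal_power I m"
    using mpoly.ideal_prod_inter[OF ideal_ideal_power[OF I] ideal_ideal_power[OF I]] by blast
  finally show ?thesis .
qed

text \<open>The trade of factors: of \<open>n\<close> factors \<open>I\<close>, keep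
  \<open>s\<close>, enlarge \<open>d\<close> to \<open>J\<close>, and drop the rest by antitonicity.
  With \<open>J = M\<close> it yields every containment that has a power of \<open>M\<close> on the
  right.\<close>

lemma ideal_power_subset_ideal_prod:
  assumes I: "ideal I mpoly_ring" and "I \<subseteq> J" and "d + s \<le> n"
  shows "ideal_power I n \<subseteq> ideal_prod mpoly_ring (ideal_power J d) (ideal_power I s)"
proof -
  have "ideal_power I n \<subseteq> ideal_power I (d + s)"
    by (rule ideal_power_antimono[OF I \<open>d + s \<le> n\<close>])
  also have "\<dots> \<subseteq> ideal_prod mpoly_ring (ideal_power J d) (ideal_power I s)"
    unfolding ideal_power_add[OF I] by (intro ideal_prod_mono ideal_power_mono \<open>I \<subseteq> J\<close> subset_refl)
  finally show ?thesis .
qed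

lemma power_in_ideal_power: "f \<in> I \<Longrightarrow> f ^ n \<in> ideal_power I n"
proof (induction n)
  case (Suc n)
  then show ?case
    using ideal_prod.prod[of "f ^ n" "ideal_power I n" f I mpoly_ring]
    by (simp add: ideal_power_Suc mult.commute)
qed simp

subsection \<open>Polynomial rings are domains\<close>

text \<open>
  The library's no-zero-divisors instance for \<open>'a \<Rightarrow>\<^sub>0 'b\<close> needs linearly ordered exponents, so
  it does not apply to an unordered index type; an additive weight that is injective on the
  finitely many exponents in question takes the place of the ordering.
\<close>

lemma additive_weight_exists:
  fixes A :: "('n::finite \<Rightarrow>\<^sub>0 nat) set"
  assumes "finite A"
  obtains w :: "('n \<Rightarrow>\<^sub>0 nat) \<Rightarrow> nat"
  where "\<And>x y. w (x + y) = w x + w y" and "inj_on w A"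
proof -
  \<comment> \<open>Induction over the set \<open>S\<close> of coordinates that the weight already
    separates; \<open>S = UNIV\<close> gives injectivity.\<close>
  have "\<exists>w :: ('n \<Rightarrow>\<^sub>0 nat) \<Rightarrow> nat. (\<forall>x y. w (x + y) = w x + w y) \<and>
      (\<forall>x\<in>A. \<forall>y\<in>A. w x = w y \<longrightarrow>
        (\<forall>i\<in>S. Poly_Mapping.lookup x i = Poly_Mapping.lookup y i))"
    if "finite S" for S
    using that
  proof induction
    case empty
    show ?case by (intro exI[of _ "\<lambda>_. 0"]) simp
  next
    case (insert j S)
    then obtain w :: "('n \<Rightarrow>\<^sub>0 nat) \<Rightarrow> nat" where
      w_add: "\<And>x y. w (x + y) = w x + w y" and
      w_inj: "\<And>x y i. x \<in> A \<Longrightarrow> y \<in> A \<Longrightarrow> w x = w y \<Longrightarrow> i \<in> S \<Longrightarrow>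
        Poly_Mapping.lookup x i = Poly_Mapping.lookup y i"
      by blast
    \<comment> \<open>A base larger than every \<open>j\<close>-th exponent in \<open>A\<close>: in
      \<open>w'\<close> the new coordinate is the last digit, so \<open>div\<close> and
      \<open>mod\<close> by \<open>B\<close> recover the old weight and that digit.\<close>
    define B where "B = Suc (\<Sum>x\<in>A. Poly_Mapping.lookup x j)"
    have B: "Poly_Mapping.lookup x j < B" if "x \<in> A" for x
      using member_le_sum[of x A "\<lambda>x. Poly_Mapping.lookup x j"] that assms
      by (simp add: B_def)
    define w' where "w' x = B * w x + Poly_Mapping.lookup x j" for x
    have "w x = w y \<and> Poly_Mapping.lookup x j = Poly_Mapping.lookup y j"
      if "x \<in> A" "y \<in> A" "w' x = w' y" for x y
    proof -
      have div: "w' z div B = w z" and mod: "w' z mod B = Poly_Mapping.lookup z j"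
        if "z \<in> A" for z
        using B[OF that] by (simp_all add: w'_def)
      show ?thesis
        using div[OF that(1)] div[OF that(2)] mod[OF that(1)] mod[OF that(2)] that(3) by simp
    qed
    moreover have "w' (x + y) = w' x + w' y" for x y
      by (simp add: w'_def w_add lookup_add algebra_simps)
    ultimately show ?case
      by (intro exI[of _ w']) (use w_inj in blast)
  qed
  from this[of UNIV] obtain w :: "('n \<Rightarrow>\<^sub>0 nat) \<Rightarrow> nat" where
    w_add: "\<And>x y. w (x + y) = w x + w y" and
    w_inj: "\<And>x y i. x \<in> A \<Longrightarrow> y \<in> A \<Longrightarrow> w x = w y \<Longrightarrow>
      Poly_Mapping.lookup x i = Poly_Mapping.lookup y i"
    by (metis UNIV_I finite)
  have "inj_on w A"
    by (intro inj_onI poly_mapping_eqI w_inj)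
  with w_add show ?thesis by (rule that)
qed

text \<open>Leading terms multiply: if \<open>p\<close> and \<open>q\<close> have maximal weight in
  the two supports, the coefficient of the product at \<open>p + q\<close> is the product of the two
  leading coefficients.\<close>

lemma mpoly_mult_eq_0_iff:
  fixes f g :: "('n::finite, 'k::field) mpoly"
  shows "f * g = 0 \<longleftrightarrow> f = 0 \<or> g = 0"
proof -
  have "f * g \<noteq> 0" if "f \<noteq> 0" "g \<noteq> 0"
  proof -
    obtain w :: "('n \<Rightarrow>\<^sub>0 nat) \<Rightarrow> nat" where
      w_add: "\<And>x y. w (x + y) = w x + w y" and
      w_inj: "inj_on w (Poly_Mapping.keys f \<union> Poly_Mapping.keys g)"
      using additive_weight_exists[OF finite_UnI[OF finite_keys finite_keys]] by metis
    have max: "\<exists>p\<in>Poly_Mapping.keys h. \<forall>p'\<in>Poly_Mapping.keys h. w p' \<le> w p"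
      if "h \<noteq> 0" for h :: "('n, 'k) mpoly"
    proof -
      have "Max (w ` Poly_Mapping.keys h) \<in> w ` Poly_Mapping.keys h"
        using that by (intro Max_in) auto
      then show ?thesis by (metis Max_ge finite_imageI finite_keys image_iff imageI)
    qed
    obtain p where p: "p \<in> Poly_Mapping.keys f"
      and p_max: "\<And>p'. p' \<in> Poly_Mapping.keys f \<Longrightarrow> w p' \<le> w p"
      using max[OF \<open>f \<noteq> 0\<close>] by blast
    obtain q where q: "q \<in> Poly_Mapping.keys g"
      and q_max: "\<And>q'. q' \<in> Poly_Mapping.keys g \<Longrightarrow> w q' \<le> w q"
      using max[OF \<open>g \<noteq> 0\<close>] by blast
    \<comment> \<open>Neither weight exceeds its maximum and the totals agree, so both weights are
      maximal; injectivity then identifies the exponents.\<close>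
    have unique: "a = p \<and> b = q"
      if "a \<in> Poly_Mapping.keys f" "b \<in> Poly_Mapping.keys g" "p + q = a + b" for a b
    proof -
      have "w p + w q = w a + w b" using that(3) by (metis w_add)
      with p_max[OF that(1)] q_max[OF that(2)] have "w a = w p" "w b = w q" by simp_all
      with w_inj that(1,2) p q show ?thesis by (auto dest: inj_onD)
    qed
    let ?t = "\<lambda>(a, b). Poly_Mapping.lookup f a * Poly_Mapping.lookup g b when p + q = a + b"
    have "Poly_Mapping.lookup (f * g) (p + q) = Sum_any ?t"
      by (simp add: times_poly_mapping.rep_eq prod_fun_unfold_prod)
    \<comment> \<open>By uniqueness the convolution sum has a single nonzero summand.\<close>
    also have "\<dots> = sum ?t {(p, q)}"
    proof (rule Sum_any.expand_superset)
      show "{ab. ?t ab \<noteq> 0} \<subseteq> {(p, q)}"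
        using unique by (auto simp: in_keys_iff when_def split: if_splits)
    qed simp
    also have "\<dots> \<noteq> 0"
      using p q by (simp add: in_keys_iff)
    finally show ?thesis by force
  qed
  then show ?thesis by auto
qed

lemma mpoly_power_eq_0_iff:
  fixes f :: "('n::finite, 'k::field) mpoly"
  shows "f ^ n = 0 \<longleftrightarrow> f = 0 \<and> n > 0"
  by (induction n) (auto simp: mpoly_mult_eq_0_iff)

subsection \<open>Degrees\<close>

abbreviation exponent_degree :: "('n::finite \<Rightarrow>\<^sub>0 nat) \<Rightarrow> nat" where
  "exponent_degree e \<equiv> \<Sum>i\<in>UNIV. Poly_Mapping.lookup e i"

text \<open>This is the \<open>d\<close>-th power of the ideal of the variables, described through
  supports so that membership can be checked on monomials.\<close>

definition degree_ge_ideal :: "nat \<Rightarrow> ('n::finite, 'k::field) mpoly set" where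
  "degree_ge_ideal d = {f. \<forall>e\<in>Poly_Mapping.keys f. d \<le> exponent_degree e}"

lemma exponent_degree_add:
  "exponent_degree (a + b) = exponent_degree a + exponent_degree b"
  by (simp add: lookup_add sum.distrib)

lemma degree_ge_ideal_mult:
  assumes "f \<in> degree_ge_ideal c" and "g \<in> degree_ge_ideal d"
  shows "f * g \<in> degree_ge_ideal (c + d)"
  unfolding degree_ge_ideal_def
proof (intro CollectI ballI)
  fix e assume "e \<in> Poly_Mapping.keys (f * g)"
  then obtain a b where "e = a + b" "a \<in> Poly_Mapping.keys f" "b \<in> Poly_Mapping.keys g"
    using keys_mult[of f g] by blast
  then show "c + d \<le> exponent_degree e"
    using assms unfolding degree_ge_ideal_def by (auto simp: exponent_degree_add intro: add_mono)
qed

lemma ideal_degree_ge_ideal: "ideal (degree_ge_ideal d) mpoly_ring"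
proof (rule ideal_ring_of_type_algebraI)
  show "c * f \<in> degree_ge_ideal d" if "f \<in> degree_ge_ideal d" for c f :: "('a, 'b) mpoly"
    \<comment> \<open>An arbitrary multiplier lies in \<open>degree_ge_ideal 0\<close>.\<close>
    using degree_ge_ideal_mult[of c 0 f d] that by (simp add: degree_ge_ideal_def)
  show "f + g \<in> degree_ge_ideal d"
    if "f \<in> degree_ge_ideal d" "g \<in> degree_ge_ideal d" for f g :: "('a, 'b) mpoly"
    using that keys_add[of f g] unfolding degree_ge_ideal_def by blast
qed (simp add: degree_ge_ideal_def)

text \<open>Lower degree bounds add up in products and survive sums. This gives the lower bound for
  \<open>alpha\<close> of a power.\<close>

lemma ideal_power_subset_degree_ge_ideal:
  assumes "I \<subseteq> degree_ge_ideal d"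
  shows "ideal_power I n \<subseteq> degree_ge_ideal (n * d)"
proof (induction n)
  case 0
  show ?case by (simp add: degree_ge_ideal_def)
next
  case (Suc n)
  show ?case
  proof
    fix f assume "f \<in> ideal_power I (Suc n)"
    then show "f \<in> degree_ge_ideal (Suc n * d)"
      unfolding ideal_power_Suc
    proof induction
      case (prod i j)
      then show ?case
        using degree_ge_ideal_mult[of i "n * d" j d] Suc.IH assms by (auto simp: add.commute)
    next
      case (sum s1 s2)
      then show ?case
        using ideal_ring_of_type_algebraD(2)[OF ideal_degree_ge_ideal] by simp
    qed
  qed
qed

lemma is_form_power: "is_form d f \<Longrightarrow> is_form (n * d) (f ^ n)"
proof (induction n)
  case 0
  show ?case by (simp add: is_form_def)
next
  case (Suc n)
  show ?case
    unfolding is_form_def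
  proof
    fix e assume "e \<in> Poly_Mapping.keys (f ^ Suc n)"
    then obtain a b where "e = a + b" "a \<in> Poly_Mapping.keys f" "b \<in> Poly_Mapping.keys (f ^ n)"
      using keys_mult[of f "f ^ n"] by auto
    then show "exponent_degree e = Suc n * d"
      using Suc unfolding is_form_def by (auto simp: exponent_degree_add)
  qed
qed

lemma is_form_degree_ge:
  assumes "f \<in> degree_ge_ideal d" and "is_form c f" and "f \<noteq> 0"
  shows "d \<le> c"
proof -
  obtain e where "e \<in> Poly_Mapping.keys f" using \<open>f \<noteq> 0\<close> by fastforce
  then show ?thesis using assms by (auto simp: degree_ge_ideal_def is_form_def)
qed

text \<open>A monomial of positive degree is divisible by some variable, and a polynomial is the sum
  of its terms.\<close>

lemma degree_ge_ideal_1_subset: "degree_ge_ideal 1 \<subseteq> irrelevant_ideal"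
proof
  fix f :: "('a, 'b) mpoly"
  assume f: "f \<in> degree_ge_ideal 1"
  have ideal: "ideal irrelevant_ideal (mpoly_ring :: ('a, 'b) mpoly ring)"
    unfolding irrelevant_ideal_def by (rule mpoly.genideal_ideal) simp
  have monom: "Poly_Mapping.single e c \<in> irrelevant_ideal"
    if deg: "1 \<le> exponent_degree e" for e :: "'a \<Rightarrow>\<^sub>0 nat" and c :: 'b
  proof -
    obtain i where i: "Poly_Mapping.lookup e i \<noteq> 0"
      using deg by fastforce
    \<comment> \<open>Subtraction of exponents is truncated; it is undone here because
      \<open>i\<close> occurs in \<open>e\<close>.\<close>
    have "e = e - Poly_Mapping.single i 1 + Poly_Mapping.single i 1"
      using i by (intro poly_mapping_eqI) (auto simp: lookup_add lookup_minus lookup_single when_def)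
    then have "Poly_Mapping.single e c = Poly_Mapping.single (e - Poly_Mapping.single i 1) c * mpoly_var i"
      by (simp add: mpoly_var_def mult_single)
    moreover have "mpoly_var i \<in> (irrelevant_ideal :: ('a, 'b) mpoly set)"
      using mpoly.genideal_self[of "range mpoly_var"] unfolding irrelevant_ideal_def by auto
    ultimately show ?thesis
      using ideal_ring_of_type_algebraD(3)[OF ideal] by simp
  qed
  have "(\<Sum>e\<in>S. Poly_Mapping.single e (Poly_Mapping.lookup f e)) \<in> irrelevant_ideal"
    if "finite S" "S \<subseteq> Poly_Mapping.keys f" for S
    using that
  proof induction
    case empty
    show ?case using ideal_ring_of_type_algebraD(1)[OF ideal] by simp
  next
    case (insert e S)
    then show ?case
      using f monom[of e] ideal_ring_of_type_algebraD(2)[OF ideal]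
      by (simp add: degree_ge_ideal_def)
  qed
  moreover have "(\<Sum>e\<in>Poly_Mapping.keys f. Poly_Mapping.single e (Poly_Mapping.lookup f e)) = f"
    by (rule poly_mapping_eqI) (simp add: lookup_sum lookup_single when_def in_keys_iff)
  ultimately show "f \<in> irrelevant_ideal" by (metis finite_keys subset_refl)
qed

subsection \<open>The initial degree\<close>

text \<open>A \<open>LEAST\<close> is informative only when a witness exists: some homogeneous
  generator is nonzero, as otherwise the ideal would be zero.\<close>

lemma alpha_attained:
  assumes "homogeneous_ideal I" and "I \<noteq> {0}"
  obtains f where "f \<in> I" "f \<noteq> 0" "is_form (alpha I) f"
proof -
  obtain S where S: "\<forall>f\<in>S. \<exists>d. is_form d f" and I: "I = genideal mpoly_ring S"
    using assms(1) unfolding homogeneous_ideal_def by blast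
  have "\<not> S \<subseteq> {0}"
  proof
    assume "S \<subseteq> {0}"
    then have "I \<subseteq> {0}"
      unfolding I using mpoly.genideal_minimal[OF mpoly.zeroideal, of S] by simp
    moreover have "0 \<in> I"
      using assms(1) ideal_ring_of_type_algebraD(1) unfolding homogeneous_ideal_def by blast
    ultimately show False using \<open>I \<noteq> {0}\<close> by blast
  qed
  then obtain f d where "f \<in> S" "f \<noteq> 0" "is_form d f" using S by blast
  moreover have "S \<subseteq> I" unfolding I by (rule mpoly.genideal_self) simp
  ultimately have "\<exists>d. \<exists>f\<in>I. f \<noteq> 0 \<and> is_form d f" by blast
  from LeastI_ex[OF this] show ?thesis
    using that unfolding alpha_def by blast
qed

text \<open>The right-hand side is an ideal, so it suffices to treat the homogeneous generators,
  where minimality of \<open>alpha\<close> applies directly.\<close>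

lemma homogeneous_ideal_subset_degree_ge_alpha:
  assumes "homogeneous_ideal I"
  shows "I \<subseteq> degree_ge_ideal (alpha I)"
proof -
  obtain S where S: "\<forall>f\<in>S. \<exists>d. is_form d f" and I: "I = genideal mpoly_ring S"
    using assms unfolding homogeneous_ideal_def by blast
  have "S \<subseteq> I" unfolding I by (rule mpoly.genideal_self) simp
  have "f \<in> degree_ge_ideal (alpha I)" if "f \<in> S" for f
  proof (cases "f = 0")
    case False
    from S that obtain d where "is_form d f" by blast
    moreover from this have "alpha I \<le> d"
      unfolding alpha_def using \<open>S \<subseteq> I\<close> that False by (intro Least_le) blast
    ultimately show ?thesis by (auto simp: degree_ge_ideal_def is_form_def)
  qed (simp add: degree_ge_ideal_def)
  then show ?thesis
    using mpoly.genideal_minimal[OF ideal_degree_ge_ideal, of S] I by blast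
qed

text \<open>A nonzero form of degree 0 is a nonzero constant, hence a unit, and would make the ideal
  the whole ring.\<close>

lemma alpha_pos:
  assumes "homogeneous_ideal I" and "I \<noteq> {0}" and "I \<noteq> UNIV"
  shows "1 \<le> alpha I"
proof (rule ccontr)
  assume "\<not> 1 \<le> alpha I"
  then obtain f where f: "f \<in> I" "f \<noteq> 0" "is_form 0 f"
    using alpha_attained[OF assms(1,2)] by (metis One_nat_def le_zero_eq not_less_eq_eq)
  have keys: "Poly_Mapping.keys f \<subseteq> {0}"
    using f(3) by (auto simp: is_form_def intro!: poly_mapping_eqI)
  define c where "c = Poly_Mapping.lookup f 0"
  have "f = Poly_Mapping.single 0 c"
    using keys by (intro poly_mapping_eqI) (auto simp: lookup_single when_def c_def in_keys_iff)
  then have "Poly_Mapping.single 0 (inverse c) * f = 1"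
    using \<open>f \<noteq> 0\<close> by (cases "c = 0") (simp_all add: mult_single)
  then have "g \<in> I" for g
    using ideal_ring_of_type_algebraD(3)[of I f "g * Poly_Mapping.single 0 (inverse c)"] f(1) assms(1)
    by (simp add: homogeneous_ideal_def mult.assoc)
  with \<open>I \<noteq> UNIV\<close> show False by blast
qed

text \<open>The power of a form of least degree attains the bound, being nonzero in a domain; the
  degree bound on \<open>ideal_power I s\<close> excludes anything smaller.\<close>

lemma alpha_ideal_power:
  assumes "homogeneous_ideal I" and "I \<noteq> {0}"
  shows "alpha (ideal_power I s) = s * alpha I"
  unfolding alpha_def[of "ideal_power I s"]
proof (rule Least_equality)
  obtain f where "f \<in> I" "f \<noteq> 0" "is_form (alpha I) f"
    using alpha_attained[OF assms] .
  then show "\<exists>f\<in>ideal_power I s. f \<noteq> 0 \<and> is_form (s * alpha I) f"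
    by (intro bexI[of _ "f ^ s"])
      (simp_all add: power_in_ideal_power is_form_power mpoly_power_eq_0_iff)
next
  fix d assume "\<exists>f\<in>ideal_power I s. f \<noteq> 0 \<and> is_form d f"
  then show "s * alpha I \<le> d"
    using ideal_power_subset_degree_ge_ideal[OF homogeneous_ideal_subset_degree_ge_alpha[OF assms(1)]]
    by (blast intro: is_form_degree_ge)
qed

lemma homogeneous_ideal_subset_irrelevant:
  assumes "homogeneous_ideal I" and "I \<noteq> {0}" and "I \<noteq> UNIV"
  shows "I \<subseteq> irrelevant_ideal"
proof -
  have "I \<subseteq> degree_ge_ideal (alpha I)"
    by (rule homogeneous_ideal_subset_degree_ge_alpha[OF assms(1)])
  also have "\<dots> \<subseteq> degree_ge_ideal 1"
    using alpha_pos[OF assms] by (force simp: degree_ge_ideal_def)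
  finally show ?thesis using degree_ge_ideal_1_subset by blast
qed

section \<open>Containments and degree bounds for the symbolic powers\<close>

theorem mainTheorem8:
  fixes I M :: "('n::finite, 'k::alg_closed_field) mpoly set"
    and N r m t :: nat
  assumes "CARD('n) = N + 1" and "N \<ge> 1"
    and "M = irrelevant_ideal"
    and "homogeneous_ideal I" and "I \<noteq> {0}" and "I \<noteq> UNIV"
    and "\<forall>s\<ge>1. symbolic_power I s = ideal_power I s"
    and "r \<ge> 1" and "m \<ge> 1" and "t \<ge> 1"
  shows
    "symbolic_power I (r * N)
       \<subseteq> ideal_prod mpoly_ring (ideal_power M (r * (N - 1))) (ideal_power I r)
     \<and> symbolic_power I (r * N - (N - 1)) \<subseteq> ideal_power I r
     \<and> (N = 2 \<and> real m / real r \<ge> 2 * real (alpha I) / (real (alpha I) + 1)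
          \<longrightarrow> symbolic_power I m \<subseteq> ideal_power I r)
     \<and> symbolic_power I (r * N - (N - 1))
       \<subseteq> ideal_prod mpoly_ring (ideal_power M ((r - 1) * (N - 1))) (ideal_power I r)
     \<and> alpha (symbolic_power I (r * N - (N - 1))) \<ge> r * alpha I + (r - 1) * (N - 1)
     \<and> (real (alpha (symbolic_power I m)) + real N - 1) / (real m + real N - 1)
       \<le> real (alpha (symbolic_power I r)) / real r
     \<and> (N \<ge> 2 \<longrightarrow> symbolic_power I (t * (m + N - 1))
          \<subseteq> ideal_prod mpoly_ring (ideal_power M t) (ideal_power (symbolic_power I m) t))
     \<and> symbolic_power I (t * (m + N - 1))
       \<subseteq> ideal_prod mpoly_ring (ideal_power M (t * (N - 1)))
           (ideal_power (symbolic_power I m) t)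
     \<and> symbolic_power I (t * (m + N - 1) - N + 1) \<subseteq> ideal_power (symbolic_power I m) t
     \<and> symbolic_power I (t * (m + N - 1) - N + 1)
       \<subseteq> ideal_prod mpoly_ring (ideal_power M ((t - 1) * (N - 1)))
           (ideal_power (symbolic_power I m) t)"
proof -
  have I: "ideal I mpoly_ring" using assms(4) by (simp add: homogeneous_ideal_def)
  have IM: "I \<subseteq> M"
    using homogeneous_ideal_subset_irrelevant[OF assms(4-6)] assms(3) by simp
  have symb: "symbolic_power I s = ideal_power I s" if "s \<ge> 1" for s
    using assms(7) that by blast
  obtain k where N: "N = Suc k" using \<open>N \<ge> 1\<close> by (cases N) auto
  obtain r' where r: "r = Suc r'" using \<open>r \<ge> 1\<close> by (cases r) auto
  obtain t' where t: "t = Suc t'" using \<open>t \<ge> 1\<close> by (cases t) auto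
  note trade = ideal_power_subset_ideal_prod[OF I IM]
  \<comment> \<open>Rewriting the exponents as sums removes truncated subtraction and displays the
    surplus factors that can be moved into \<open>M\<close>.\<close>
  have exp_r: "r * N - (N - 1) = r + (r - 1) * (N - 1)"
    by (simp add: N r algebra_simps)
  have exp_t: "t * (m + N - 1) - N + 1 = m * t + (t - 1) * (N - 1)"
  proof -
    have "t * (m + N - 1) = m * t + (t - 1) * (N - 1) + k"
      by (simp add: N t algebra_simps)
    \<comment> \<open>Ensures that \<open>N = k + 1\<close> can be subtracted without truncation, so
      that \<open>- N + 1\<close> really removes \<open>k\<close>.\<close>
    moreover have "1 \<le> m * t" using \<open>m \<ge> 1\<close> \<open>t \<ge> 1\<close> by simp
    ultimately show ?thesis using N by simp
  qed
  have a: "1 \<le> alpha I" by (rule alpha_pos[OF assms(4-6)])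
  have symb_t: "symbolic_power I (t * (m + N - 1)) = ideal_power I (t * (m + N - 1))"
    using \<open>m \<ge> 1\<close> \<open>t \<ge> 1\<close> by (intro symb) (simp add: N)
  have symb_t': "symbolic_power I (t * (m + N - 1) - N + 1) = ideal_power I (m * t + (t - 1) * (N - 1))"
    unfolding exp_t using \<open>m \<ge> 1\<close> \<open>t \<ge> 1\<close> by (intro symb) (simp add: trans_le_add1)
  have symb_r': "symbolic_power I (r * N - (N - 1)) = ideal_power I (r + (r - 1) * (N - 1))"
    unfolding exp_r using \<open>r \<ge> 1\<close> by (intro symb) simp
  have pow: "ideal_power (symbolic_power I m) t = ideal_power I (m * t)"
    using symb[OF \<open>m \<ge> 1\<close>] ideal_power_power[OF I] by simp

  have "symbolic_power I (r * N)
      \<subseteq> ideal_prod mpoly_ring (ideal_power M (r * (N - 1))) (ideal_power I r)"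
    using symb[of "r * N"] trade[of "r * (N - 1)" r "r * N"] by (simp add: N r)
  moreover have "symbolic_power I (r * N - (N - 1)) \<subseteq> ideal_power I r"
    unfolding symb_r' by (rule ideal_power_antimono[OF I]) simp
  moreover have "symbolic_power I m \<subseteq> ideal_power I r"
    if "real m / real r \<ge> 2 * real (alpha I) / (real (alpha I) + 1)"
  proof -
    \<comment> \<open>As \<open>alpha I\<close> is at least 1, the threshold is at least 1, so the
      hypothesis forces \<open>r \<le> m\<close>.\<close>
    have "1 \<le> 2 * real (alpha I) / (real (alpha I) + 1)"
      using a by (simp add: field_simps)
    with that have "1 \<le> real m / real r" by linarith
    then have "r \<le> m" using \<open>r \<ge> 1\<close> by (simp add: field_simps)
    then show ?thesis
      using symb[OF \<open>m \<ge> 1\<close>] ideal_power_antimono[OF I] by simp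
  qed
  moreover have "symbolic_power I (r * N - (N - 1))
      \<subseteq> ideal_prod mpoly_ring (ideal_power M ((r - 1) * (N - 1))) (ideal_power I r)"
    unfolding symb_r' by (rule trade) simp
  moreover have "alpha (symbolic_power I (r * N - (N - 1))) \<ge> r * alpha I + (r - 1) * (N - 1)"
  proof -
    \<comment> \<open>Each surplus factor of \<open>I\<close> contributes degree
      \<open>alpha I\<close>, hence at least 1.\<close>
    have "(r - 1) * (N - 1) \<le> (r - 1) * (N - 1) * alpha I" using a by simp
    then show ?thesis
      unfolding symb_r' alpha_ideal_power[OF assms(4,5)] by (simp add: add_mult_distrib)
  qed
  moreover have "(real (alpha (symbolic_power I m)) + real N - 1) / (real m + real N - 1)
      \<le> real (alpha (symbolic_power I r)) / real r"
  proof -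
    \<comment> \<open>The right-hand quotient is just \<open>alpha I\<close>; after clearing the
      other denominator and cancelling \<open>m * alpha I\<close>, this inequality is what
      remains.\<close>
    have "real k \<le> real k * real (alpha I)" using a by (simp add: mult_le_cancel_left1)
    then have "real (alpha (symbolic_power I m)) + real N - 1
        \<le> real (alpha I) * (real m + real N - 1)"
      using symb[OF \<open>m \<ge> 1\<close>] alpha_ideal_power[OF assms(4,5)]
      by (simp add: N algebra_simps)
    moreover have "real (alpha (symbolic_power I r)) / real r = real (alpha I)"
      using symb[OF \<open>r \<ge> 1\<close>] alpha_ideal_power[OF assms(4,5)] \<open>r \<ge> 1\<close> by simp
    moreover have "0 < real m + real N - 1" using \<open>m \<ge> 1\<close> \<open>N \<ge> 1\<close> by simp
    ultimately show ?thesis by (simp add: pos_divide_le_eq)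
  qed
  moreover have "symbolic_power I (t * (m + N - 1))
      \<subseteq> ideal_prod mpoly_ring (ideal_power M t) (ideal_power (symbolic_power I m) t)"
    if "N \<ge> 2"
    unfolding symb_t pow
  proof (rule trade)
    \<comment> \<open>There are \<open>t * k\<close> surplus factors, and \<open>N \<ge> 2\<close>
      makes \<open>k\<close> positive, so \<open>t\<close> of them can be traded.\<close>
    have "t \<le> t * k" using that N by simp
    then show "t + m * t \<le> t * (m + N - 1)" by (simp add: N algebra_simps)
  qed
  moreover have "symbolic_power I (t * (m + N - 1))
      \<subseteq> ideal_prod mpoly_ring (ideal_power M (t * (N - 1)))
          (ideal_power (symbolic_power I m) t)"
    unfolding symb_t pow by (rule trade) (simp add: N algebra_simps)
  moreover have "symbolic_power I (t * (m + N - 1) - N + 1)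
      \<subseteq> ideal_power (symbolic_power I m) t"
    unfolding symb_t' pow by (rule ideal_power_antimono[OF I]) simp
  moreover have "symbolic_power I (t * (m + N - 1) - N + 1)
      \<subseteq> ideal_prod mpoly_ring (ideal_power M ((t - 1) * (N - 1)))
          (ideal_power (symbolic_power I m) t)"
    unfolding symb_t' pow by (rule trade) simp
  ultimately show ?thesis by blast
qed

end
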